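(* Let $p:E\to B$ be a Hurewicz fibration with fibre $F$, where $E$, $B$ and $F$ are path-connected topological spaces. Then $$\mathrm{TC}(E)\le \mathrm{TC}(F)\cdot \mathrm{cat}(B\times B).$$
   Context: All topological spaces are assumed to be path-connected and all maps continuous. $\mathrm{TC}(X)$ (topological complexity) is the Schwarz genus of the path fibration $\pi:X^I\to X\times X$, $\pi(\gamma)=(\gamma(0),\gamma(1))$, where $X^I$ is the space of all paths $\gamma:I=[0,1]\to X$ with the compact-open topology; that is, $\mathrm{TC}(X)$ is the least integer $k$ such that $X\times X$ can be covered by $k$ open sets on each of which $\pi$ admits a continuous local section. $\mathrm{cat}(X)$ is the (unreduced) Lusternik-Schnirelmann category, i.e. the Schwarz genus of the Serre path fibration $P_0X\to X$, $\gamma\mapsto\gamma(1)$, where $P_0X$ is the space of paths in $X$ starting at a fixed base point; equivalently, the least integer $k$ such that $X$ can be covered by $k$ open sets each of whose inclusions into $X$ is null-homotopic. *)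

theory Defs
  imports "HOL-Analysis.Analysis"
begin

text \<open>The set of continuous maps from \<open>X\<close> to \<open>Y\<close>, as extensional functions, with the
  compact-open topology. The sets indexed below form the usual subbase; \<open>K = {}\<close> yields the
  whole carrier.\<close>

definition compact_open_topology :: "'a topology \<Rightarrow> 'b topology \<Rightarrow> ('a \<Rightarrow> 'b) topology" where
  "compact_open_topology X Y =
     topology_generated_by
       {{g \<in> extensional (topspace X). continuous_map X Y g \<and> g ` K \<subseteq> U} | K U.
          compactin X K \<and> openin Y U}"

abbreviation unit_interval :: "real topology" where
  "unit_interval \<equiv> top_of_set {0..1}"

definition path_space :: "'a topology \<Rightarrow> (real \<Rightarrow> 'a) topology" where
  "path_space X = compact_open_topology unit_interval X"

definition based_path_space :: "'a topology \<Rightarrow> 'a \<Rightarrow> (real \<Rightarrow> 'a) topology" where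
  "based_path_space X x0 = subtopology (path_space X) {g. g 0 = x0}"

definition has_local_section :: "'e topology \<Rightarrow> 'b topology \<Rightarrow> ('e \<Rightarrow> 'b) \<Rightarrow> 'b set \<Rightarrow> bool" where
  "has_local_section E B p U \<longleftrightarrow>
     (\<exists>s. continuous_map (subtopology B U) E s \<and> (\<forall>x\<in>topspace B \<inter> U. p (s x) = x))"

text \<open>The value is \<open>\<infinity>\<close> (the infimum of the empty set) if no finite cover exists.\<close>

definition schwarz_genus :: "'e topology \<Rightarrow> 'b topology \<Rightarrow> ('e \<Rightarrow> 'b) \<Rightarrow> enat" where
  "schwarz_genus E B p =
     Inf {enat k | k. \<exists>U :: nat \<Rightarrow> 'b set.
            (\<forall>i<k. openin B (U i) \<and> has_local_section E B p (U i)) \<and>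
            (\<Union>i<k. U i) = topspace B}"

definition TC :: "'a topology \<Rightarrow> enat" where
  "TC X = schwarz_genus (path_space X) (prod_topology X X) (\<lambda>g. (g 0, g 1))"

definition LS_cat :: "'a topology \<Rightarrow> 'a \<Rightarrow> enat" where
  "LS_cat X x0 = schwarz_genus (based_path_space X x0) X (\<lambda>g. g 1)"

definition homotopy_lifting_property ::
    "'z topology \<Rightarrow> 'e topology \<Rightarrow> 'b topology \<Rightarrow> ('e \<Rightarrow> 'b) \<Rightarrow> bool" where
  "homotopy_lifting_property Z E B p \<longleftrightarrow>
     (\<forall>f h. continuous_map Z E f \<and> continuous_map (prod_topology Z unit_interval) B h \<and>
            (\<forall>z\<in>topspace Z. h (z, 0) = p (f z)) \<longrightarrow>
        (\<exists>H. continuous_map (prod_topology Z unit_interval) E H \<and>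
             (\<forall>z\<in>topspace Z. H (z, 0) = f z) \<and>
             (\<forall>z\<in>topspace Z. \<forall>t\<in>{0..1}. p (H (z, t)) = h (z, t))))"

text \<open>A definition cannot quantify over all types, so the test spaces \<open>Z\<close> range over all
  topologies on one type. That type is large enough to carry the universal test space
  \<open>E \<times>\<^sub>B B\<^sup>I\<close>, so nothing is lost: by the theorem \<open>hurewicz_fibration_lifting\<close> below the
  homotopy lifting property follows for test spaces of arbitrary type.\<close>

definition hurewicz_fibration :: "'e topology \<Rightarrow> 'b topology \<Rightarrow> ('e \<Rightarrow> 'b) \<Rightarrow> bool" where
  "hurewicz_fibration E B p \<longleftrightarrow>
     continuous_map E B p \<and>
     (\<forall>Z :: ('e \<times> (real \<Rightarrow> 'b)) topology. homotopy_lifting_property Z E B p)"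

definition fibre :: "'e topology \<Rightarrow> ('e \<Rightarrow> 'b) \<Rightarrow> 'b \<Rightarrow> 'e topology" where
  "fibre E p b = subtopology E {e. p e = b}"

lemma topspace_compact_open_topology:
  "topspace (compact_open_topology X Y) = {g \<in> extensional (topspace X). continuous_map X Y g}"
proof -
  have "\<exists>K U. g ` K \<subseteq> U \<and> compactin X K \<and> openin Y U" for g :: "'a \<Rightarrow> 'b"
    by (rule exI[of _ "{}"], rule exI[of _ "{}"]) auto
  then show ?thesis
    unfolding compact_open_topology_def topology_generated_by_topspace by blast
qed

lemma topspace_path_space:
  "topspace (path_space X) = {g \<in> extensional {0..1}. pathin X g}"
  by (simp add: path_space_def topspace_compact_open_topology pathin_def)

lemma continuous_map_path_space_eval:
  "continuous_map (prod_topology (path_space X) unit_interval) X (\<lambda>(g, t). g t)"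
  unfolding continuous_map
proof (intro conjI allI impI)
  show "(\<lambda>(g, t). g t) ` topspace (prod_topology (path_space X) unit_interval) \<subseteq> topspace X"
    by (auto simp: topspace_path_space pathin_def continuous_map_def)
next
  fix V assume V: "openin X V"
  let ?S = "{x \<in> topspace (prod_topology (path_space X) unit_interval). (case x of (g, t) \<Rightarrow> g t) \<in> V}"
  show "openin (prod_topology (path_space X) unit_interval) ?S"
    unfolding openin_prod_topology_alt
  proof (intro allI impI)
    fix g t assume "(g, t) \<in> ?S"
    then have g: "g \<in> extensional {0..1}" "continuous_map unit_interval X g"
      and t: "t \<in> {0..1}" and gt: "g t \<in> V"
      by (auto simp: topspace_path_space pathin_def)
    have "openin unit_interval {s \<in> {0..1}. g s \<in> V}"
      using openin_continuous_map_preimage[OF g(2) V] by simp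
    then obtain e where e: "e > 0" "cball t e \<inter> {0..1} \<subseteq> {s \<in> {0..1}. g s \<in> V}"
      using t gt by (force simp: openin_contains_cball)
    let ?K = "cball t e \<inter> {0..1}"
    let ?U = "{f \<in> extensional {0..1}. continuous_map unit_interval X f \<and> f ` ?K \<subseteq> V}"
    have "compactin unit_interval ?K"
      by (simp add: compactin_subtopology compact_Int)
    then have "openin (path_space X) ?U"
      unfolding path_space_def compact_open_topology_def
      using V by (intro topology_generated_by_Basis) auto
    moreover have "openin unit_interval (ball t e \<inter> {0..1})"
      by (metis inf_commute open_ball openin_open_Int)
    moreover have "g \<in> ?U" using e g by auto
    moreover have "t \<in> ball t e \<inter> {0..1}" using t e by simp
    moreover have "?U \<times> (ball t e \<inter> {0..1}) \<subseteq> ?S"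
      by (auto simp: topspace_path_space pathin_def image_subset_iff)
    ultimately show "\<exists>U W. openin (path_space X) U \<and> openin unit_interval W \<and>
        g \<in> U \<and> t \<in> W \<and> U \<times> W \<subseteq> ?S"
      by blast
  qed
qed

lemma continuous_map_path_space_curry:
  assumes h: "continuous_map (prod_topology Z unit_interval) X h"
  shows "continuous_map Z (path_space X) (\<lambda>z. restrict (\<lambda>t. h (z, t)) {0..1})"
    (is "continuous_map _ _ ?c")
proof -
  have cz: "continuous_map unit_interval X (?c z)" if "z \<in> topspace Z" for z
  proof -
    have "continuous_map unit_interval (prod_topology Z unit_interval) (\<lambda>t. (z, t))"
      using that by (simp add: continuous_map_pairwise o_def)
    then have "continuous_map unit_interval X (\<lambda>t. h (z, t))"
      using continuous_map_compose[OF _ h] by (force simp: o_def)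
    then show ?thesis
      by (rule continuous_map_eq) simp
  qed
  show ?thesis
    unfolding path_space_def compact_open_topology_def
  proof (rule continuous_on_generated_topo)
    fix S assume "S \<in> {{g \<in> extensional (topspace unit_interval).
        continuous_map unit_interval X g \<and> g ` K \<subseteq> U} |K U. compactin unit_interval K \<and> openin X U}"
    then obtain K U where K: "compactin unit_interval K" and U: "openin X U"
      and S: "S = {g \<in> extensional {0..1}. continuous_map unit_interval X g \<and> g ` K \<subseteq> U}"
      by auto
    have K01: "K \<subseteq> {0..1}" using compactin_subset_topspace[OF K] by simp
    let ?W = "{x \<in> topspace (prod_topology Z unit_interval). h x \<in> U}"
    have W: "openin (prod_topology Z unit_interval) ?W"
      by (rule openin_continuous_map_preimage[OF h U])
    have eq: "?c -` S \<inter> topspace Z = {z \<in> topspace Z. {z} \<times> K \<subseteq> ?W}"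
      using K01 cz by (auto simp: S image_subset_iff subset_iff)
    show "openin Z (?c -` S \<inter> topspace Z)"
      unfolding eq
    proof (subst openin_subopen, intro ballI)
      fix z assume "z \<in> {z \<in> topspace Z. {z} \<times> K \<subseteq> ?W}"
      then have z: "z \<in> topspace Z" "{z} \<times> K \<subseteq> ?W" by blast+
      obtain N M where "openin Z N" "z \<in> N" "K \<subseteq> M" "N \<times> M \<subseteq> ?W"
        using tube_lemma_right[OF W K z] by blast
      then show "\<exists>T. openin Z T \<and> z \<in> T \<and> T \<subseteq> {z \<in> topspace Z. {z} \<times> K \<subseteq> ?W}"
        using openin_subset[of Z N] by (intro exI[of _ N]) blast
    qed
  next
    have "?c z \<in> topspace (compact_open_topology unit_interval X)" if "z \<in> topspace Z" for z
      using cz[OF that] by (simp add: topspace_compact_open_topology)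
    then show "?c ` topspace Z \<subseteq> \<Union> {{g \<in> extensional (topspace unit_interval).
        continuous_map unit_interval X g \<and> g ` K \<subseteq> U} |K U. compactin unit_interval K \<and> openin X U}"
      unfolding compact_open_topology_def topology_generated_by_topspace by blast
  qed
qed

theorem hurewicz_fibration_lifting:
  fixes Z :: "'z topology" and E :: "'e topology" and B :: "'b topology"
  assumes p: "hurewicz_fibration E B p"
  shows "homotopy_lifting_property Z E B p"
  unfolding homotopy_lifting_property_def
proof (intro allI impI, elim conjE)
  fix f h
  assume f: "continuous_map Z E f" and h: "continuous_map (prod_topology Z unit_interval) B h"
    and fh: "\<forall>z\<in>topspace Z. h (z, 0) = p (f z)"
  define W where "W = subtopology (prod_topology E (path_space B)) {x. snd x 0 = p (fst x)}"
  define c where "c = (\<lambda>z. (f z, restrict (\<lambda>t. h (z, t)) {0..1}))"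
  have c: "continuous_map Z W c"
    using f continuous_map_path_space_curry[OF h] fh
    by (auto simp: W_def c_def continuous_map_in_subtopology continuous_map_pairwise o_def)
  have "continuous_map W E fst"
    unfolding W_def by (intro continuous_map_from_subtopology continuous_map_fst)
  moreover have "continuous_map (prod_topology W unit_interval) B (\<lambda>x. (snd (fst x)) (snd x))"
  proof -
    have "continuous_map W (path_space B) snd"
      unfolding W_def by (intro continuous_map_from_subtopology continuous_map_snd)
    from continuous_map_compose[OF continuous_map_fst this]
    have "continuous_map (prod_topology W unit_interval) (prod_topology (path_space B) unit_interval)
        (\<lambda>x. (snd (fst x), snd x))"
      by (simp add: continuous_map_pairwise o_def continuous_map_snd)
    from continuous_map_compose[OF this continuous_map_path_space_eval]
    show ?thesis by (simp add: o_def)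
  qed
  moreover have hlp: "homotopy_lifting_property W E B p"
    using p by (simp add: hurewicz_fibration_def)
  moreover have "\<forall>w\<in>topspace W. (snd (fst (w, 0::real))) (snd (w, 0)) = p (fst w)"
    by (auto simp: W_def)
  ultimately obtain H where H: "continuous_map (prod_topology W unit_interval) E H"
    and H0: "\<forall>w\<in>topspace W. H (w, 0) = fst w"
    and pH: "\<forall>w\<in>topspace W. \<forall>t\<in>{0..1}. p (H (w, t)) = snd w t"
    using hlp[unfolded homotopy_lifting_property_def, rule_format,
        of fst "\<lambda>x. (snd (fst x)) (snd x)"] by auto
  have cW: "c z \<in> topspace W" if "z \<in> topspace Z" for z
    using c that by (auto simp: continuous_map_def)
  have "continuous_map (prod_topology Z unit_interval) (prod_topology W unit_interval)
      (\<lambda>x. (c (fst x), snd x))"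
    using continuous_map_compose[OF continuous_map_fst c]
    by (simp add: continuous_map_pairwise o_def continuous_map_snd)
  from continuous_map_compose[OF this H]
  have "continuous_map (prod_topology Z unit_interval) E (\<lambda>x. H (c (fst x), snd x))"
    by (simp add: o_def)
  then show "\<exists>H. continuous_map (prod_topology Z unit_interval) E H \<and>
      (\<forall>z\<in>topspace Z. H (z, 0) = f z) \<and>
      (\<forall>z\<in>topspace Z. \<forall>t\<in>{0..1}. p (H (z, t)) = h (z, t))"
    using cW H0 pH by (intro exI[of _ "\<lambda>x. H (c (fst x), snd x)"]) (simp add: c_def)
qed

end

theory Submission
  imports Defs
begin

text \<open>Over an open subset of \<open>B \<times> B\<close> on which the based path fibration has a section, a pair
  \<open>(e, e')\<close> comes with paths in \<open>B\<close> from \<open>p e\<close> and \<open>p e'\<close> to \<open>b\<close> that depend continuously on it.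
  Lifting them moves \<open>e\<close> and \<open>e'\<close> into the fibre over \<open>b\<close>; a motion planner on the fibre connects
  the two end points, and running the second lift backwards completes a path from \<open>e\<close> to \<open>e'\<close>.
  Intersecting the two covers gives the product.\<close>

section \<open>Schwarz genus and finite open covers\<close>

text \<open>Enumerating \<open>I\<close> turns any finite index set into an initial segment of the
  naturals; this allows a cover indexed by pairs later on.\<close>

lemma schwarz_genus_le_card:
  assumes I: "finite I"
    and U: "\<And>i. i \<in> I \<Longrightarrow> openin B (U i) \<and> has_local_section E B p (U i)"
    and cov: "(\<Union>i\<in>I. U i) = topspace B"
  shows "schwarz_genus E B p \<le> enat (card I)"
proof -
  obtain f where f: "bij_betw f {..<card I} I"
    using ex_bij_betw_nat_finite[OF I] by (auto simp: atLeast0LessThan)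
  then have "f ` {..<card I} = I"
    by (simp add: bij_betw_def)
  then have "(\<Union>i<card I. U (f i)) = topspace B" "\<forall>i<card I. f i \<in> I"
    using cov by (simp_all flip: image_image) (metis imageI lessThan_iff)
  then show ?thesis
    unfolding schwarz_genus_def using U
    by (intro Inf_lower CollectI exI[of _ "card I"] conjI exI[of _ "\<lambda>i. U (f i)"]) auto
qed

text \<open>The infimum of a nonempty set of extended naturals is attained, and a finite value
  excludes the empty set, whose infimum is \<infinity>. Hence an optimal cover exists.\<close>

lemma schwarz_genus_cover:
  assumes "schwarz_genus E B p = enat k"
  obtains U :: "nat \<Rightarrow> 'b set"
  where "\<And>i. i < k \<Longrightarrow> openin B (U i)" "\<And>i. i < k \<Longrightarrow> has_local_section E B p (U i)"
    "(\<Union>i<k. U i) = topspace B"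
proof -
  let ?S = "{enat k | k. \<exists>U :: nat \<Rightarrow> 'b set.
            (\<forall>i<k. openin B (U i) \<and> has_local_section E B p (U i)) \<and>
            (\<Union>i<k. U i) = topspace B}"
  have eq: "Inf ?S = enat k"
    using assms by (simp only: schwarz_genus_def)
  then have "?S \<noteq> {}"
    by (metis Inf_empty enat.distinct(1) top_enat_def)
  then have "Inf ?S \<in> ?S"
    unfolding Inf_enat_def by (simp only: if_False) (metis (mono_tags, lifting) LeastI ex_in_conv)
  then show thesis
    unfolding eq using that by auto
qed

text \<open>The empty family covers only the empty space. This matters because
  \<open>0 * \<infinity> = 0\<close> in \<open>enat\<close>: a vanishing factor would spoil the
  bound when the other factor is infinite.\<close>

lemma schwarz_genus_nonzero:
  assumes "topspace B \<noteq> {}"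
  shows "schwarz_genus E B p \<noteq> 0"
proof
  assume "schwarz_genus E B p = 0"
  then show False
    unfolding zero_enat_def by (rule schwarz_genus_cover) (use assms in simp)
qed

section \<open>Continuous families of paths as maps on \<open>Z \<times> [0,1]\<close>\<close>

text \<open>Evaluation of paths is jointly continuous, so maps into the path space can be uncurried.
  From here on, paths are reversed and joined on the product, away from the compact-open
  topology.\<close>

lemma local_section_path_family:
  assumes "continuous_map Z (path_space X) s"
  shows "continuous_map (prod_topology Z unit_interval) X (\<lambda>x. s (fst x) (snd x))"
proof -
  have "continuous_map (prod_topology Z unit_interval) (prod_topology (path_space X) unit_interval)
      (\<lambda>x. (s (fst x), snd x))"
    using continuous_map_compose[OF continuous_map_fst assms]
    by (simp add: continuous_map_pairwise o_def continuous_map_snd)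
  from continuous_map_compose[OF this continuous_map_path_space_eval]
  show ?thesis by (simp add: o_def)
qed

lemma path_family_pullback:
  assumes "continuous_map Z Y f" "continuous_map (prod_topology Y unit_interval) X h"
  shows "continuous_map (prod_topology Z unit_interval) X (\<lambda>x. h (f (fst x), snd x))"
proof -
  have "continuous_map (prod_topology Z unit_interval) (prod_topology Y unit_interval)
      (\<lambda>x. (f (fst x), snd x))"
    using continuous_map_compose[OF continuous_map_fst assms(1)]
    by (simp add: continuous_map_pairwise o_def continuous_map_snd)
  from continuous_map_compose[OF this assms(2)] show ?thesis
    by (simp add: o_def)
qed

lemma path_family_eval:
  assumes "continuous_map (prod_topology Z unit_interval) X h" "t \<in> {0..1}"
  shows "continuous_map Z X (\<lambda>z. h (z, t))"
proof -
  have "continuous_map Z (prod_topology Z unit_interval) (\<lambda>z. (z, t))"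
    using assms(2) by (simp add: continuous_map_pairwise o_def)
  from continuous_map_compose[OF this assms(1)] show ?thesis
    by (simp add: o_def)
qed

text \<open>The set \<open>A\<close> is there for reparametrisations such as \<open>2 * t\<close>
  and \<open>2 * t - 1\<close>, which stay inside the unit interval only on one half of it.\<close>

lemma path_family_reparam:
  assumes h: "continuous_map (prod_topology Z unit_interval) X h"
    and f: "continuous_on UNIV f" "\<And>x. x \<in> A \<Longrightarrow> f (snd x) \<in> {0..1}"
  shows "continuous_map (subtopology (prod_topology Z unit_interval) A) X (\<lambda>x. h (fst x, f (snd x)))"
proof -
  have "continuous_map (prod_topology Z unit_interval) euclideanreal (\<lambda>x. f (snd x))"
    using continuous_map_compose[OF continuous_map_snd, of unit_interval euclideanreal f Z]
      continuous_on_subset[OF f(1)] by (simp add: o_def)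
  then have "continuous_map (subtopology (prod_topology Z unit_interval) A) unit_interval
      (\<lambda>x. f (snd x))"
    using f(2) by (auto simp: continuous_map_in_subtopology continuous_map_from_subtopology)
  then have "continuous_map (subtopology (prod_topology Z unit_interval) A)
      (prod_topology Z unit_interval) (\<lambda>x. (fst x, f (snd x)))"
    by (simp add: continuous_map_pairwise o_def continuous_map_from_subtopology continuous_map_fst)
  from continuous_map_compose[OF this h] show ?thesis
    by (simp add: o_def)
qed

lemma path_family_reverse:
  assumes h: "continuous_map (prod_topology Z unit_interval) X h"
  shows "continuous_map (prod_topology Z unit_interval) X (\<lambda>x. h (fst x, 1 - snd x))"
proof -
  have "continuous_map (subtopology (prod_topology Z unit_interval) (UNIV \<times> {0..1})) X
      (\<lambda>x. h (fst x, 1 - snd x))"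
    by (rule path_family_reparam[OF h]) (auto intro!: continuous_intros)
  moreover have "subtopology (prod_topology Z unit_interval) (UNIV \<times> {0..1})
      = prod_topology Z unit_interval"
    by (rule subtopology_superset) auto
  ultimately show ?thesis by simp
qed

text \<open>Concatenation at double speed, continuous by pasting along the closed sets where the
  time is at most, or at least, \<open>1/2\<close>. The end values can be read off the formula, so
  they hold for every \<open>z\<close>, even outside the carrier.\<close>

lemma path_family_join:
  assumes h: "continuous_map (prod_topology Z unit_interval) X h"
    and k: "continuous_map (prod_topology Z unit_interval) X k"
    and eq: "\<And>z. z \<in> topspace Z \<Longrightarrow> h (z, 1) = k (z, 0)"
  obtains g where "continuous_map (prod_topology Z unit_interval) X g"
    "\<And>z. g (z, 0) = h (z, 0)" "\<And>z. g (z, 1) = k (z, 1)"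
proof
  let ?P = "prod_topology Z unit_interval"
  let ?g = "\<lambda>x. if snd x \<le> 1/2 then h (fst x, 2 * snd x) else k (fst x, 2 * snd x - 1)"
  have snd: "continuous_map ?P euclideanreal snd"
    using continuous_map_snd[of Z unit_interval] by (simp add: continuous_map_in_subtopology)
  show "continuous_map ?P X ?g"
  proof (rule continuous_map_cases_le[OF snd])
    show "continuous_map ?P euclideanreal (\<lambda>x. 1/2)" by simp
    show "continuous_map (subtopology ?P {x \<in> topspace ?P. snd x \<le> 1/2}) X (\<lambda>x. h (fst x, 2 * snd x))"
      by (rule path_family_reparam[OF h]) (auto intro!: continuous_intros)
    show "continuous_map (subtopology ?P {x \<in> topspace ?P. 1/2 \<le> snd x}) X
        (\<lambda>x. k (fst x, 2 * snd x - 1))"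
      by (rule path_family_reparam[OF k]) (auto intro!: continuous_intros)
    fix x assume x: "x \<in> topspace ?P" "snd x = 1/2"
    then show "h (fst x, 2 * snd x) = k (fst x, 2 * snd x - 1)"
      using eq[of "fst x"] by (simp add: mem_Times_iff del: divide_eq_eq_numeral1 eq_divide_eq_numeral1)
  qed
qed auto

text \<open>By currying and uncurrying, a local section of the path fibration amounts to a homotopy
  over \<open>U\<close> between the two projections.\<close>

lemma motion_planner_iff:
  "has_local_section (path_space X) (prod_topology X X) (\<lambda>g. (g 0, g 1)) U \<longleftrightarrow>
     (\<exists>h. continuous_map (prod_topology (subtopology (prod_topology X X) U) unit_interval) X h \<and>
          (\<forall>x \<in> topspace (prod_topology X X) \<inter> U. h (x, 0) = fst x \<and> h (x, 1) = snd x))"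
    (is "?L \<longleftrightarrow> ?R")
proof
  assume ?L
  then obtain s where s: "continuous_map (subtopology (prod_topology X X) U) (path_space X) s"
    "\<forall>x\<in>topspace (prod_topology X X) \<inter> U. (s x 0, s x 1) = x"
    by (auto simp: has_local_section_def)
  have "s x 0 = fst x \<and> s x 1 = snd x" if "x \<in> topspace (prod_topology X X) \<inter> U" for x
    using s(2) that by (metis fst_conv snd_conv)
  then show ?R
    using local_section_path_family[OF s(1)] by (intro exI[of _ "\<lambda>x. s (fst x) (snd x)"]) simp
next
  assume ?R
  then obtain h where h:
    "continuous_map (prod_topology (subtopology (prod_topology X X) U) unit_interval) X h"
    "\<forall>x \<in> topspace (prod_topology X X) \<inter> U. h (x, 0) = fst x \<and> h (x, 1) = snd x"
    by blast
  show ?L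
    unfolding has_local_section_def
    by (rule exI, rule conjI, rule continuous_map_path_space_curry[OF h(1)]) (use h(2) in simp)
qed

section \<open>Contractions in the base and lifts ending in a fibre\<close>

lemma hurewicz_fibration_lift_into_fibre:
  assumes p: "hurewicz_fibration E B p"
    and f: "continuous_map Z E f"
    and h: "continuous_map (prod_topology Z unit_interval) B h"
    and "\<And>z. z \<in> topspace Z \<Longrightarrow> h (z, 0) = p (f z)"
    and hb: "\<And>z. z \<in> topspace Z \<Longrightarrow> h (z, 1) = b"
  obtains H where "continuous_map (prod_topology Z unit_interval) E H"
    "\<And>z. z \<in> topspace Z \<Longrightarrow> H (z, 0) = f z"
    "continuous_map Z (fibre E p b) (\<lambda>z. H (z, 1))"
proof -
  obtain H where H: "continuous_map (prod_topology Z unit_interval) E H"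
    "\<forall>z\<in>topspace Z. H (z, 0) = f z" "\<forall>z\<in>topspace Z. \<forall>t\<in>{0..1}. p (H (z, t)) = h (z, t)"
    using hurewicz_fibration_lifting[OF p, of Z] assms(2-4)
    unfolding homotopy_lifting_property_def by blast
  have "continuous_map Z (fibre E p b) (\<lambda>z. H (z, 1))"
    unfolding fibre_def continuous_map_in_subtopology
    using path_family_eval[OF H(1), of 1] H(3) hb by auto
  with H that show thesis by blast
qed

text \<open>The section gives paths from \<open>c\<close> to \<open>x\<close>; these are reversed
  and followed by one fixed path from \<open>c\<close> to \<open>d\<close>. The base point used for
  the category is thus independent of the point to which \<open>U\<close> is contracted.\<close>

lemma contracting_family:
  assumes sec: "has_local_section (based_path_space X c) X (\<lambda>g. g 1) U"
    and X: "path_connected_space X" and c: "c \<in> topspace X" and d: "d \<in> topspace X"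
  obtains h where "continuous_map (prod_topology (subtopology X U) unit_interval) X h"
    "\<And>x. x \<in> topspace X \<inter> U \<Longrightarrow> h (x, 0) = x" "\<And>x. h (x, 1) = d"
proof -
  let ?Z = "subtopology X U"
  obtain s where s: "continuous_map ?Z (path_space X) s"
    and s0: "\<And>x. x \<in> topspace X \<inter> U \<Longrightarrow> s x 0 = c"
    and s1: "\<And>x. x \<in> topspace X \<inter> U \<Longrightarrow> s x 1 = x"
    using sec unfolding has_local_section_def based_path_space_def continuous_map_in_subtopology
    by fastforce
  \<comment> \<open>The path from \<open>c\<close> to \<open>x\<close> run backwards, in the
    unreduced form in which \<open>path_family_reverse\<close> delivers it.\<close>
  let ?h = "\<lambda>x. s (fst (fst x, 1 - snd x)) (snd (fst x, 1 - snd x))"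
  have h: "continuous_map (prod_topology ?Z unit_interval) X ?h"
    using path_family_reverse[OF local_section_path_family[OF s]] .
  obtain g where g: "pathin X g" "g 0 = c" "g 1 = d"
    using X c d by (auto simp: path_connected_space_def)
  have k: "continuous_map (prod_topology ?Z unit_interval) X (\<lambda>x. g (snd x))"
    using continuous_map_compose[OF continuous_map_snd, of unit_interval X g ?Z] g(1)
    by (simp add: pathin_def o_def)
  show thesis
    by (rule path_family_join[OF h k]) (use s0 s1 g that in auto)
qed

lemma path_connected_space_prod_topology:
  assumes "path_connected_space X" "path_connected_space Y"
  shows "path_connected_space (prod_topology X Y)"
  unfolding path_connected_space_def
proof (intro allI impI ballI)
  fix u v assume "u \<in> topspace (prod_topology X Y)" "v \<in> topspace (prod_topology X Y)"
  with assms obtain f g where "pathin X f" "f 0 = fst u" "f 1 = fst v"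
    "pathin Y g" "g 0 = snd u" "g 1 = snd v"
    unfolding path_connected_space_def topspace_prod_topology mem_Times_iff by meson
  then show "\<exists>k. pathin (prod_topology X Y) k \<and> k 0 = u \<and> k 1 = v"
    by (intro exI[of _ "\<lambda>t. (f t, g t)"]) (simp add: pathin_def continuous_map_pairwise o_def)
qed

text \<open>A path in the base from \<open>p e\<close> to \<open>b\<close>, lifted from
  \<open>e\<close>, ends in the fibre over \<open>b\<close>.\<close>

lemma fibre_nonempty:
  assumes p: "hurewicz_fibration E B p" and "path_connected_space B" "b \<in> topspace B"
    and e: "e \<in> topspace E"
  shows "topspace (fibre E p b) \<noteq> {}"
proof -
  have cp: "continuous_map E B p"
    using p by (simp add: hurewicz_fibration_def)
  then have "p e \<in> topspace B"
    using e by (auto simp: continuous_map_def)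
  then obtain g where g: "pathin B g" "g 0 = p e" "g 1 = b"
    using assms(2,3) by (auto simp: path_connected_space_def)
  \<comment> \<open>With a one-point test space, homotopy lifting becomes path lifting.\<close>
  let ?Z = "subtopology E {e}"
  have k: "continuous_map (prod_topology ?Z unit_interval) B (\<lambda>x. g (snd x))"
    using continuous_map_compose[OF continuous_map_snd, of unit_interval B g ?Z] g(1)
    by (simp add: pathin_def o_def)
  have "continuous_map ?Z E (\<lambda>x. x)"
    by (simp add: continuous_map_from_subtopology)
  then obtain H where "continuous_map ?Z (fibre E p b) (\<lambda>z. H (z, 1::real))"
    using hurewicz_fibration_lift_into_fibre[OF p _ k, of "\<lambda>x. x" b] g by fastforce
  then show ?thesis
    using e by (auto simp: continuous_map_def)
qed

section \<open>Motion planners over one member of the cover of the base\<close>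

text \<open>The map \<open>q\<close> takes a pair to the end points of its two lifts. It is obtained
  before \<open>V\<close> is given, so that a single \<open>q\<close> serves all members of a cover
  of the product of the fibre with itself.\<close>

lemma motion_planner_fibration:
  fixes E :: "'e topology" and B :: "'b topology"
  assumes p: "hurewicz_fibration E B p"
    and b: "b \<in> topspace B" and c: "c \<in> topspace (prod_topology B B)"
    and B: "path_connected_space B"
    and sec: "has_local_section (based_path_space (prod_topology B B) c) (prod_topology B B)
                (\<lambda>g. g 1) U"
  obtains q where
    "continuous_map (subtopology (prod_topology E E) (map_prod p p -` U))
       (prod_topology (fibre E p b) (fibre E p b)) q"
    "\<And>V. has_local_section (path_space (fibre E p b))
        (prod_topology (fibre E p b) (fibre E p b)) (\<lambda>g. (g 0, g 1)) V \<Longrightarrow>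
       has_local_section (path_space E) (prod_topology E E) (\<lambda>g. (g 0, g 1))
         (map_prod p p -` U \<inter> q -` V)"
proof -
  let ?F = "fibre E p b"
  define Z where "Z = subtopology (prod_topology E E) (map_prod p p -` U)"
  have cp: "continuous_map E B p"
    using p by (simp add: hurewicz_fibration_def)
  have cfst: "continuous_map Z E fst" and csnd: "continuous_map Z E snd"
    unfolding Z_def by (auto intro: continuous_map_from_subtopology continuous_map_fst continuous_map_snd)
  obtain h where h:
    "continuous_map (prod_topology (subtopology (prod_topology B B) U) unit_interval)
       (prod_topology B B) h"
    and h0: "\<And>x. x \<in> topspace (prod_topology B B) \<inter> U \<Longrightarrow> h (x, 0) = x"
    and h1: "\<And>x. h (x, 1) = (b, b)"
    \<comment> \<open>Contracting to a diagonal point brings both components of the homotopy to the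
      same \<open>b\<close>, hence both lifts into the same fibre.\<close>
    using contracting_family[OF sec path_connected_space_prod_topology[OF B B] c, of "(b, b)"] b
    by auto
  have pp: "continuous_map Z (subtopology (prod_topology B B) U) (map_prod p p)"
    using continuous_map_compose[OF cfst cp] continuous_map_compose[OF csnd cp]
    by (auto simp: continuous_map_in_subtopology continuous_map_pairwise o_def Z_def)
  define k where "k = (\<lambda>x. h (map_prod p p (fst x), snd x))"
  have k: "continuous_map (prod_topology Z unit_interval) (prod_topology B B) k"
    unfolding k_def by (rule path_family_pullback[OF pp h])
  have k0: "k (z, 0) = map_prod p p z" if "z \<in> topspace Z" for z
    using h0[of "map_prod p p z"] pp that by (auto simp: k_def continuous_map_def)
  have k1: "k (z, 1) = (b, b)" for z
    by (simp add: k_def h1)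
  have kf: "continuous_map (prod_topology Z unit_interval) B (\<lambda>x. fst (k x))"
    and ks: "continuous_map (prod_topology Z unit_interval) B (\<lambda>x. snd (k x))"
    using k by (simp_all add: continuous_map_pairwise o_def)
  obtain H where H: "continuous_map (prod_topology Z unit_interval) E H"
    and H0: "\<And>z. z \<in> topspace Z \<Longrightarrow> H (z, 0) = fst z"
    and H1: "continuous_map Z ?F (\<lambda>z. H (z, 1))"
    by (rule hurewicz_fibration_lift_into_fibre[OF p cfst kf]) (auto simp: k0 k1)
  obtain K where K: "continuous_map (prod_topology Z unit_interval) E K"
    and K0: "\<And>z. z \<in> topspace Z \<Longrightarrow> K (z, 0) = snd z"
    and K1: "continuous_map Z ?F (\<lambda>z. K (z, 1))"
    by (rule hurewicz_fibration_lift_into_fibre[OF p csnd ks]) (auto simp: k0 k1)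
  define q where "q = (\<lambda>z. (H (z, 1), K (z, 1)))"
  have q: "continuous_map Z (prod_topology ?F ?F) q"
    using H1 K1 by (simp add: q_def continuous_map_pairwise o_def)
  show thesis
  proof (rule that)
    show "continuous_map (subtopology (prod_topology E E) (map_prod p p -` U)) (prod_topology ?F ?F) q"
      using q by (simp add: Z_def)
  next
    fix V
    assume "has_local_section (path_space ?F) (prod_topology ?F ?F) (\<lambda>g. (g 0, g 1)) V"
    then obtain m where m:
      "continuous_map (prod_topology (subtopology (prod_topology ?F ?F) V) unit_interval) ?F m"
      and m01: "\<forall>x \<in> topspace (prod_topology ?F ?F) \<inter> V. m (x, 0) = fst x \<and> m (x, 1) = snd x"
      by (auto simp: motion_planner_iff)
    define W where "W = map_prod p p -` U \<inter> q -` V"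
    define Y where "Y = subtopology (prod_topology E E) W"
    \<comment> \<open>\<open>W\<close> lies in the preimage of \<open>U\<close>, so the maps
      \<open>H\<close>, \<open>K\<close> and \<open>q\<close> on \<open>Z\<close> all restrict to
      \<open>Y\<close>.\<close>
    have Y: "Y = subtopology Z W"
      by (simp add: Y_def Z_def W_def subtopology_subtopology Int_absorb1 Int_absorb2 Int_ac)
    have YZ: "continuous_map Y Z (\<lambda>z. z)"
      by (simp add: Y continuous_map_from_subtopology)
    have topY: "z \<in> topspace Z \<and> q z \<in> V" if "z \<in> topspace Y" for z
      using that by (auto simp: Y W_def)
    have qY: "continuous_map Y (subtopology (prod_topology ?F ?F) V) q"
      using q topY by (auto simp: Y continuous_map_in_subtopology continuous_map_from_subtopology)
    have HY: "continuous_map (prod_topology Y unit_interval) E (\<lambda>x. H (fst x, snd x))"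
      by (rule path_family_pullback[OF YZ H])
    have KY: "continuous_map (prod_topology Y unit_interval) E (\<lambda>x. K (fst x, 1 - snd x))"
      using path_family_reverse[OF path_family_pullback[OF YZ K]] by simp
    have "continuous_map ?F E (\<lambda>x. x)"
      by (simp add: fibre_def continuous_map_from_subtopology)
    from continuous_map_compose[OF path_family_pullback[OF qY m] this]
    have mY: "continuous_map (prod_topology Y unit_interval) E (\<lambda>x. m (q (fst x), snd x))"
      by (simp add: o_def)
    have m0: "m (q z, 0) = H (z, 1)" and m1: "m (q z, 1) = K (z, 1)" if "z \<in> topspace Y" for z
    proof -
      have "q z \<in> topspace (prod_topology ?F ?F) \<inter> V"
        using continuous_map_image_subset_topspace[OF qY] that by auto
      then show "m (q z, 0) = H (z, 1)" "m (q z, 1) = K (z, 1)"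
        using m01 by (auto simp: q_def)
    qed
    \<comment> \<open>Two joins produce the path \<open>H\<close>, then \<open>m\<close> inside the
      fibre, then \<open>K\<close> backwards; \<open>m0\<close> and \<open>m1\<close> match the
      ends.\<close>
    obtain g where g: "continuous_map (prod_topology Y unit_interval) E g"
      and g0: "\<And>z. g (z, 0) = H (z, 0)" and g1: "\<And>z. g (z, 1) = m (q z, 1)"
      by (rule path_family_join[OF HY mY]) (auto simp: m0)
    obtain l where l: "continuous_map (prod_topology Y unit_interval) E l"
      and l0: "\<And>z. l (z, 0) = g (z, 0)" and l1: "\<And>z. l (z, 1) = K (z, 0)"
      by (rule path_family_join[OF g KY]) (auto simp: g1 m1)
    have "l (z, 0) = fst z \<and> l (z, 1) = snd z" if "z \<in> topspace (prod_topology E E) \<inter> W" for z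
      using that topY[of z] H0 K0 by (auto simp: l0 l1 g0 Y_def)
    then show "has_local_section (path_space E) (prod_topology E E) (\<lambda>g. (g 0, g 1))
         (map_prod p p -` U \<inter> q -` V)"
      using l unfolding motion_planner_iff Y_def W_def by blast
  qed
qed

section \<open>The product cover and the inequality\<close>

theorem lemma7:
  fixes E :: "'e topology" and B :: "'b topology" and p :: "'e \<Rightarrow> 'b"
    and b :: 'b and c :: "'b \<times> 'b"
  assumes "hurewicz_fibration E B p"
    and "b \<in> topspace B"
    and "c \<in> topspace (prod_topology B B)"
    and "path_connected_space E"
    and "path_connected_space B"
    and "path_connected_space (fibre E p b)"
  shows "TC E \<le> TC (fibre E p b) * LS_cat (prod_topology B B) c"
proof (cases "topspace E = {}")
  case True
  \<comment> \<open>An empty \<open>E\<close> is covered by no sets at all, so its complexity is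
    0.\<close>
  then have "TC E \<le> enat (card ({} :: nat set))"
    unfolding TC_def by (intro schwarz_genus_le_card[of _ _ "\<lambda>_. {}"]) auto
  then show ?thesis
    by (simp add: zero_enat_def[symmetric])
next
  case False
  let ?F = "fibre E p b"
  let ?FF = "prod_topology ?F ?F" and ?BB = "prod_topology B B" and ?EE = "prod_topology E E"
  have cp: "continuous_map E B p"
    using assms(1) by (simp add: hurewicz_fibration_def)
  have "topspace ?F \<noteq> {}"
    using False fibre_nonempty[OF assms(1,5,2)] by blast
  then have "TC ?F \<noteq> 0"
    unfolding TC_def by (intro schwarz_genus_nonzero) simp
  moreover have "LS_cat ?BB c \<noteq> 0"
    unfolding LS_cat_def using assms(3) by (intro schwarz_genus_nonzero) blast
  moreover have ?thesis if m: "TC ?F = enat m" and n: "LS_cat ?BB c = enat n" for m n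
  proof -
    obtain V where V: "\<And>j. j < m \<Longrightarrow> openin ?FF (V j)"
      "\<And>j. j < m \<Longrightarrow> has_local_section (path_space ?F) ?FF (\<lambda>g. (g 0, g 1)) (V j)"
      and Vcov: "(\<Union>j<m. V j) = topspace ?FF"
      using schwarz_genus_cover[OF m[unfolded TC_def]] by blast
    obtain U where U: "\<And>i. i < n \<Longrightarrow> openin ?BB (U i)"
      "\<And>i. i < n \<Longrightarrow> has_local_section (based_path_space ?BB c) ?BB (\<lambda>g. g 1) (U i)"
      and Ucov: "(\<Union>i<n. U i) = topspace ?BB"
      using schwarz_genus_cover[OF n[unfolded LS_cat_def]] by blast
    \<comment> \<open>One \<open>q\<close> is fixed for each \<open>i\<close>, uniformly in
      \<open>j\<close>; otherwise the preimages of the sets \<open>V j\<close> need not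
      cover.\<close>
    have "\<forall>i\<in>{..<n}. \<exists>q. continuous_map (subtopology ?EE (map_prod p p -` U i)) ?FF q \<and>
        (\<forall>j<m. has_local_section (path_space E) ?EE (\<lambda>g. (g 0, g 1))
          (map_prod p p -` U i \<inter> q -` V j))"
    proof
      fix i assume "i \<in> {..<n}"
      then have "i < n" by simp
      show "\<exists>q. continuous_map (subtopology ?EE (map_prod p p -` U i)) ?FF q \<and>
        (\<forall>j<m. has_local_section (path_space E) ?EE (\<lambda>g. (g 0, g 1))
          (map_prod p p -` U i \<inter> q -` V j))"
        by (rule motion_planner_fibration[OF assms(1,2,3,5) U(2)[OF \<open>i < n\<close>]], rule exI, rule conjI)
          (assumption, use V(2) in blast)
    qed
    from bchoice[OF this] obtain q where
      q: "\<And>i. i < n \<Longrightarrow> continuous_map (subtopology ?EE (map_prod p p -` U i)) ?FF (q i)"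
      and sec: "\<And>i j. i < n \<Longrightarrow> j < m \<Longrightarrow> has_local_section (path_space E) ?EE (\<lambda>g. (g 0, g 1))
          (map_prod p p -` U i \<inter> q i -` V j)"
      by (auto simp only: lessThan_iff Ball_def)
    have pp: "continuous_map ?EE ?BB (map_prod p p)"
      using continuous_map_compose[OF continuous_map_fst cp, of E]
        continuous_map_compose[OF continuous_map_snd cp, of E]
      by (simp add: continuous_map_pairwise o_def)
    \<comment> \<open>Preimages under total functions may contain points outside the carrier, hence
      the intersection with it; the induced subspace stays the same.\<close>
    define W where "W = (\<lambda>(i, j). topspace ?EE \<inter> (map_prod p p -` U i \<inter> q i -` V j))"
    have op: "openin ?EE (W (i, j))" if ij: "i < n" "j < m" for i j
    proof -
      have o: "openin ?EE (topspace ?EE \<inter> map_prod p p -` U i)"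
        using openin_continuous_map_preimage[OF pp U(1)[OF ij(1)]]
        by (simp add: Collect_conj_eq vimage_def)
      \<comment> \<open>Continuity of \<open>q i\<close> is known only over \<open>U i\<close>, so
        openness is first shown in that subspace, which is itself open by \<open>o\<close>.\<close>
      have "openin (subtopology ?EE (map_prod p p -` U i)) (W (i, j))"
        using openin_continuous_map_preimage[OF q V(1), OF ij]
        by (rule back_subst) (auto simp: W_def)
      then have "openin (subtopology ?EE (topspace ?EE \<inter> map_prod p p -` U i)) (W (i, j))"
        by (metis subtopology_restrict)
      then show ?thesis
        using o openin_open_subtopology by blast
    qed
    have "has_local_section (path_space E) ?EE (\<lambda>g. (g 0, g 1)) (W (i, j))" if "i < n" "j < m" for i j
      using sec[OF that] unfolding W_def prod.case has_local_section_def
      by (metis Int_left_absorb subtopology_restrict)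
    moreover have "(\<Union>x\<in>{..<n} \<times> {..<m}. W x) = topspace ?EE"
    proof
      show "topspace ?EE \<subseteq> (\<Union>x\<in>{..<n} \<times> {..<m}. W x)"
      proof
        fix x assume x: "x \<in> topspace ?EE"
        then have "map_prod p p x \<in> topspace ?BB"
          using continuous_map_image_subset_topspace[OF pp] by blast
        then obtain i where i: "i < n" "map_prod p p x \<in> U i"
          using Ucov by blast
        \<comment> \<open>The index \<open>i\<close> comes first, because the point to be located in
          the cover by the \<open>V j\<close> depends on it.\<close>
        then have "q i x \<in> topspace ?FF"
          using continuous_map_image_subset_topspace[OF q[OF i(1)]] x by auto
        then obtain j where "j < m" "q i x \<in> V j"
          using Vcov by blast
        with x i show "x \<in> (\<Union>x\<in>{..<n} \<times> {..<m}. W x)"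
          by (auto simp: W_def intro!: bexI[of _ "(i, j)"])
      qed
    qed (auto simp: W_def)
    ultimately have "TC E \<le> enat (card ({..<n} \<times> {..<m}))"
      unfolding TC_def by (intro schwarz_genus_le_card[of _ _ W]) (use op in auto)
    then show ?thesis
      by (simp add: m n mult.commute)
  qed
  ultimately show ?thesis
    \<comment> \<open>If a factor is infinite, the other is nonzero, so the product is \<infinity>
      and the bound is trivial.\<close>
    by (cases "TC ?F"; cases "LS_cat ?BB c") (auto simp: zero_enat_def)
qed

end
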